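(* Let $\mathbf{a}=(a_{1},\ldots,a_{n})\in\mathbb{C}^n$ and $\mathbf{b}=(b_{1},\ldots,b_{m})\in\mathbb{C}^m$ be two $Id$-quiddity sequences. Then $\mathbf{a}\circ_{k}\mathbf{b}$ is an $Id$-quiddity sequence for $k=1,\ldots,n$, where $$\mathbf{a}\circ_{k}\mathbf{b}=(a_{1},\ldots, a_{k-1},a_{k}+b_{1}-1,b_{2},\ldots,b_{m-1},b_{m}-1,a_{k+1}-1,a_{k+2},\ldots,a_{n})$$ for $k\neq n$, and $$\mathbf{a}\circ_{n}\mathbf{b}=(a_{1}-1,a_{2},\ldots,a_{n-1},a_{n}+b_{1}-1,b_{2},\ldots,b_{m-1},b_{m}-1).$$
   Context: A vector $(a_1,\ldots,a_n)\in\mathbb{C}^n$ is called an $Id$-quiddity sequence if $$\begin{pmatrix} a_{n} & -1\\ 1 & 0\end{pmatrix}\begin{pmatrix} a_{n-1} & -1\\ 1 & 0\end{pmatrix}\cdots\begin{pmatrix} a_{1} & -1\\ 1 & 0\end{pmatrix}=Id,$$ the $2\times 2$ identity matrix. *)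

theory Defs
  imports "HOL-Analysis.Analysis"
begin

definition qmat :: "complex \<Rightarrow> complex ^ 2 ^ 2" where
  "qmat c = vector [vector [c, -1], vector [1, 0]]"

(* The factors appear in reverse order: M(a_n) ** ... ** M(a_1), and mat 1 for the empty list. *)
primrec quiddity_prod :: "complex list \<Rightarrow> complex ^ 2 ^ 2" where
  "quiddity_prod [] = mat 1"
| "quiddity_prod (c # cs) = quiddity_prod cs ** qmat c"

definition Id_quiddity :: "complex list \<Rightarrow> bool" where
  "Id_quiddity a \<longleftrightarrow> quiddity_prod a = mat 1"

(* The index k is 1-based, list positions are 0-based: a_i is a ! (i - 1).
   Only meaningful for 1 \<le> k \<le> length a and nonempty b. The stretch b_2, ..., b_(m-1)
   is tl (butlast b). *)
definition quiddity_comp :: "complex list \<Rightarrow> nat \<Rightarrow> complex list \<Rightarrow> complex list" where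
  "quiddity_comp a k b =
     (if k \<noteq> length a
      then take (k - 1) a @ [a ! (k - 1) + hd b - 1] @ tl (butlast b) @ [last b - 1]
             @ [a ! k - 1] @ drop (k + 1) a
      else [hd a - 1] @ tl (butlast a) @ [last a + hd b - 1] @ tl (butlast b) @ [last b - 1])"

end

theory Submission
  imports Defs
begin

text \<open>
  Adding \<open>d\<close> to the argument of \<^const>\<open>qmat\<close> amounts to multiplication by an elementary matrix, upper
  triangular on the left and lower triangular on the right. Hence the block
  \<open>x + b\<^sub>1 - 1, b\<^sub>2, \<dots>, b\<^sub>m - 1, y - 1\<close> contributes the product of \<open>b\<close>, which is the
  identity, surrounded by elementary matrices, and these collapse to the contribution of
  \<open>x, y\<close>. The case \<open>k = n\<close> is the same replacement up to a cyclic rotation.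
\<close>

definition upper_unitri :: "complex \<Rightarrow> complex ^ 2 ^ 2" where
  "upper_unitri d = vector [vector [1, d], vector [0, 1]]"

definition lower_unitri :: "complex \<Rightarrow> complex ^ 2 ^ 2" where
  "lower_unitri d = vector [vector [1, 0], vector [d, 1]]"

lemmas mat2_simps = vec_eq_iff forall_2 matrix_matrix_mult_def sum_2 vector_2
  qmat_def upper_unitri_def lower_unitri_def mat_def

lemma qmat_add_left: "qmat (c + d) = upper_unitri d ** qmat c"
  by (simp add: mat2_simps)

lemma qmat_add_right: "qmat (c + d) = qmat c ** lower_unitri (- d)"
  by (simp add: mat2_simps)

text \<open>Indeed \<open>upper_unitri (- 1) ** lower_unitri (1 - x) = lower_unitri (- 1) ** qmat
  x\<close>, and \<open>qmat (y - 1)\<close> absorbs \<open>lower_unitri (- 1)\<close> to become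
  \<open>qmat y\<close>.\<close>

lemma qmat_mult_unitri:
  "qmat (y - 1) ** upper_unitri (- 1) ** lower_unitri (1 - x) = qmat y ** qmat x"
  by (simp add: mat2_simps algebra_simps)

lemma quiddity_prod_append: "quiddity_prod (xs @ ys) = quiddity_prod ys ** quiddity_prod xs"
  by (induction xs) (simp_all add: matrix_mul_assoc)

text \<open>A one-sided inverse of a square matrix is two-sided.\<close>

lemma Id_quiddity_rotate: "Id_quiddity (xs @ ys) \<longleftrightarrow> Id_quiddity (ys @ xs)"
  by (simp add: Id_quiddity_def quiddity_prod_append matrix_left_right_inverse)

text \<open>The lower right entry of \<open>qmat c\<close> is 0. The bound ensures that the first
  and last entries sit at different positions.\<close>

lemma Id_quiddity_length_ge_2:
  assumes "Id_quiddity xs" "xs \<noteq> []"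
  shows "length xs \<ge> 2"
proof (rule ccontr)
  assume "\<not> length xs \<ge> 2"
  then obtain c where "xs = [c]"
    using assms(2) by (cases xs) (auto simp: Suc_le_eq)
  then show False
    using assms(1) by (simp add: Id_quiddity_def mat2_simps)
qed

lemma hd_middle_last:
  assumes "length xs \<ge> 2"
  shows "xs = hd xs # tl (butlast xs) @ [last xs]"
  using assms by (cases xs) (auto split: if_splits)

lemma quiddity_prod_insert:
  assumes "Id_quiddity (p # w @ [q])"
  shows "quiddity_prod ((x + p - 1) # w @ [q - 1, y - 1]) = quiddity_prod [x, y]"
proof -
  have Id: "qmat q ** quiddity_prod w ** qmat p = mat 1"
    using assms by (simp add: Id_quiddity_def quiddity_prod_append)
  \<comment> \<open>Written as shifts of \<open>q\<close> and \<open>p\<close>, the end entries shed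
    their elementary factors outwards, which exposes the product in \<open>Id\<close>.\<close>
  have "quiddity_prod ((x + p - 1) # w @ [q - 1, y - 1])
      = qmat (y - 1) ** qmat (q + - 1) ** quiddity_prod w ** qmat (p + (x - 1))"
    by (simp add: quiddity_prod_append algebra_simps)
  also have "\<dots> = qmat (y - 1) ** upper_unitri (- 1)
      ** (qmat q ** quiddity_prod w ** qmat p) ** lower_unitri (1 - x)"
    unfolding qmat_add_left[of q] qmat_add_right[of p] by (simp add: matrix_mul_assoc)
  also have "\<dots> = quiddity_prod [x, y]"
    by (simp add: Id qmat_mult_unitri)
  finally show ?thesis .
qed

lemma Id_quiddity_insert:
  assumes "Id_quiddity (p # w @ [q])" "Id_quiddity (u @ [x, y] @ v)"
  shows "Id_quiddity (u @ ((x + p - 1) # w @ [q - 1, y - 1]) @ v)"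
  using assms(2) unfolding Id_quiddity_def quiddity_prod_append[of u]
    quiddity_prod_append[of _ v] quiddity_prod_insert[OF assms(1)] .

theorem theorem14:
  fixes a b :: "complex list" and n m k :: nat
  assumes "length a = n" and "length b = m"
    and "n \<ge> 1" and "m \<ge> 1"
    and "Id_quiddity a" and "Id_quiddity b"
    and "k \<in> {1..n}"
  shows "Id_quiddity (quiddity_comp a k b)"
proof -
  define w where "w = tl (butlast b)"
  have "b = hd b # w @ [last b]"
    unfolding w_def using assms by (intro hd_middle_last Id_quiddity_length_ge_2) auto
  then have b: "Id_quiddity (hd b # w @ [last b])"
    using assms(6) by simp
  show ?thesis
  proof (cases "k = n")
    case True
    define v where "v = tl (butlast a)"
    have "a = hd a # v @ [last a]"
      unfolding v_def using assms by (intro hd_middle_last Id_quiddity_length_ge_2) auto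
    then have "Id_quiddity ((hd a # v) @ [last a])"
      using assms(5) by simp
    \<comment> \<open>Rotation makes the cyclic neighbours \<open>last a\<close> and
      \<open>hd a\<close> adjacent.\<close>
    then have "Id_quiddity ([] @ [last a, hd a] @ v)"
      by (subst (asm) Id_quiddity_rotate) simp
    from Id_quiddity_insert[OF b this]
    have "Id_quiddity (((last a + hd b - 1) # w @ [last b - 1]) @ ((hd a - 1) # v))"
      by simp
    then show ?thesis
      by (subst (asm) Id_quiddity_rotate)
        (simp add: quiddity_comp_def True assms(1) v_def w_def)
  next
    case False
    \<comment> \<open>As \<open>k\<close> is positive, \<open>k - 1\<close> is not truncated, so the
      entries at \<open>k - 1\<close> and \<open>k\<close> are consecutive.\<close>
    then have k: "k - 1 < length a" "k < length a" "Suc (k - 1) = k"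
      using assms by auto
    have "a = take (k - 1) a @ [a ! (k - 1), a ! k] @ drop (k + 1) a"
      using id_take_nth_drop[OF k(1)] Cons_nth_drop_Suc[OF k(2)] k(3) by simp
    then have "Id_quiddity (take (k - 1) a @ [a ! (k - 1), a ! k] @ drop (k + 1) a)"
      using assms(5) by simp
    from Id_quiddity_insert[OF b this] show ?thesis
      using False by (simp add: quiddity_comp_def assms(1) w_def)
  qed
qed

end
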